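(* Let $(P,\ell,\mathcal F)$ be a learning problem with optimal $f^*$ and let $\bar\eta>0$. Assume that the strong $\bar\eta$-central condition holds, i.e. $\mathbf E[e^{-\bar\eta L_f}]\le1$ for all $f\in\mathcal F$. For $0<\eta<\bar\eta$, $u>0$ and $c\in(0,1]$ let $c_u:=\frac1c\,\frac{\eta u+1}{1-\eta/\bar\eta}$. (i) Suppose the $(u,c)$-witness condition holds for some $u>0$ and $c\in(0,1]$. Then for all $f\in\mathcal F$ and all $\eta\in(0,\bar\eta)$, $$\mathbf E[L_f]\ \le\ c_u\cdot\mathbf E^{\mathrm{HE}(\eta)}[L_f]\ \le\ c_u\cdot\mathbf E^{\mathrm{ANN}(\eta)}[L_f].$$ (ii) More generally, suppose that the $(\tau,c)$-witness condition holds for some $c\in(0,1]$ and a non-increasing function $\tau$. Then for all $\lambda>0$, all $f\in\mathcal F$ and all $\eta\in(0,\bar\eta)$, $$\mathbf E[L_f]\ \le\ \lambda\vee\big(c_{\tau(\lambda)}\cdot\mathbf E^{\mathrm{HE}(\eta)}[L_f]\big)\ \le\ \lambda\vee\big(c_{\tau(\lambda)}\cdot\mathbf E^{\mathrm{ANN}(\eta)}[L_f]\big).$$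
   Context: Learning problem $(P,\ell,\mathcal F)$: $P$ is a probability distribution on a measurable sample space $\mathcal Z$; $\mathcal F$ is a set (the model); $\ell:\mathcal F\times\mathcal Z\to\mathbb R\cup\{\infty\}$ is a loss, $\ell_f(z):=\ell(f,z)$; $\ell_f$ also denotes the random variable $\ell_f(Z)$ with $Z\sim P$; $\mathbf E$ is expectation under $P$. Standing assumptions: (1) unless $\ell$ is (conditional) log loss, $\inf_{f\in\mathcal F}\inf_{z\in\mathcal Z}\ell_f(z)>-\infty$; (2) if $\ell$ is (conditional) log loss $\ell_f=-\log p_f$, all $p_f$ are probability densities relative to a common dominating measure $\mu$, $P\ll\mu$, $\mathrm{KL}(P\|P_{f^*})<\infty$ and the differential entropy of $P$ relative to $\mu$ is $>-\infty$; (3) $\mathbf E[\ell_f]<\infty$ for some $f\in\mathcal F$; (4) there is an optimal $f^*\in\mathcal F$, i.e. $\mathbf E[\ell_f-\ell_{f^*}]\ge 0$ for all $f\in\mathcal F$; one such $f^*$ is fixed. Excess loss: $L_f:=\ell_f-\ell_{f^*}$. Notation $a\vee b=\max\{a,b\}$. Hellinger-transformed and annealed expectations of a random variable $U$, for $\eta>0$: $\mathbf E^{\mathrm{HE}(\eta)}[U]:=\frac1\eta(1-\mathbf E[e^{-\eta U}])$ and $\mathbf E^{\mathrm{ANN}(\eta)}[U]:=-\frac1\eta\log\mathbf E[e^{-\eta U}]$. Witness conditions: the $(u,c)$-witness condition holds if for all $f\in\mathcal F$, $\mathbf E[L_f\cdot\mathbf 1_{\{L_f\le u\}}]\ge c\,\mathbf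 E[L_f]$. For a function $\tau:[0,\infty)\to[1,\infty)$, the $(\tau,c)$-witness condition holds if for all $f\in\mathcal F$, $\mathbf E[L_f]<\infty$ and $\mathbf E[L_f\cdot\mathbf 1_{\{L_f\le\tau(\mathbf E[L_f])\}}]\ge c\,\mathbf E[L_f]$. *)

theory Defs
  imports "HOL-Probability.Probability"
begin

text \<open>
  Losses take values in \<open>ereal\<close>, since a loss may be \<open>\<infinity>\<close>, and so do expectations.  The Bochner
  integral is real-valued and returns \<open>0\<close> for non-integrable functions, so it cannot express
  an infinite expectation.  An undefined expectation (both parts infinite) evaluates
  to \<open>\<infinity> - \<infinity> = \<infinity>\<close> in \<open>ereal\<close>.
\<close>

definition ext_expectation :: "'z measure \<Rightarrow> ('z \<Rightarrow> ereal) \<Rightarrow> ereal" where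
  "ext_expectation M U =
     enn2ereal (\<integral>\<^sup>+ z. e2ennreal (U z) \<partial>M) - enn2ereal (\<integral>\<^sup>+ z. e2ennreal (- U z) \<partial>M)"

definition has_ext_expectation :: "'z measure \<Rightarrow> ('z \<Rightarrow> ereal) \<Rightarrow> bool" where
  "has_ext_expectation M U \<longleftrightarrow>
     (\<integral>\<^sup>+ z. e2ennreal (U z) \<partial>M) < \<infinity> \<or> (\<integral>\<^sup>+ z. e2ennreal (- U z) \<partial>M) < \<infinity>"

lemma ext_expectation_eq_integral:
  assumes "integrable M g"
  shows "ext_expectation M (\<lambda>z. ereal (g z)) = ereal (integral\<^sup>L M g)"
proof -
  have pos: "(\<integral>\<^sup>+ z. ennreal (g z) \<partial>M) < \<infinity>" and neg: "(\<integral>\<^sup>+ z. ennreal (- g z) \<partial>M) < \<infinity>"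
    using assms by (auto simp: real_integrable_def less_top)
  have "e2ennreal (- ereal r) = ennreal (- r)" for r
    by (simp add: e2ennreal_ereal)
  then have "ext_expectation M (\<lambda>z. ereal (g z)) =
      enn2ereal (\<integral>\<^sup>+ z. ennreal (g z) \<partial>M) - enn2ereal (\<integral>\<^sup>+ z. ennreal (- g z) \<partial>M)"
    unfolding ext_expectation_def by simp
  also have "\<dots> = ereal (enn2real (\<integral>\<^sup>+ z. ennreal (g z) \<partial>M) - enn2real (\<integral>\<^sup>+ z. ennreal (- g z) \<partial>M))"
    using pos neg
    by (cases "\<integral>\<^sup>+ z. ennreal (g z) \<partial>M"; cases "\<integral>\<^sup>+ z. ennreal (- g z) \<partial>M") auto
  finally show ?thesis
    using assms by (simp add: real_lebesgue_integral_def)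
qed

definition exp_ereal :: "ereal \<Rightarrow> ereal" where
  "exp_ereal x = (case x of ereal r \<Rightarrow> ereal (exp r) | PInfty \<Rightarrow> \<infinity> | MInfty \<Rightarrow> 0)"

definition ln_ereal :: "ereal \<Rightarrow> ereal" where
  "ln_ereal x = (case x of ereal r \<Rightarrow> (if 0 < r then ereal (ln r) else - \<infinity>)
                         | PInfty \<Rightarrow> \<infinity> | MInfty \<Rightarrow> - \<infinity>)"

definition hellinger_expectation :: "'z measure \<Rightarrow> real \<Rightarrow> ('z \<Rightarrow> ereal) \<Rightarrow> ereal" where
  "hellinger_expectation P \<eta> U =
     ereal (1 / \<eta>) * (1 - ext_expectation P (\<lambda>z. exp_ereal (ereal (- \<eta>) * U z)))"

definition annealed_expectation :: "'z measure \<Rightarrow> real \<Rightarrow> ('z \<Rightarrow> ereal) \<Rightarrow> ereal" where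
  "annealed_expectation P \<eta> U =
     ereal (- (1 / \<eta>)) * ln_ereal (ext_expectation P (\<lambda>z. exp_ereal (ereal (- \<eta>) * U z)))"

text \<open>
  The Kullback--Leibler divergence in nats, with value \<open>\<infinity>\<close> permitted (unlike
  \<open>KL_divergence\<close>, which is real-valued).
\<close>

definition ext_KL :: "'z measure \<Rightarrow> 'z measure \<Rightarrow> ereal" where
  "ext_KL P Q =
     (if absolutely_continuous Q P
      then ext_expectation P (\<lambda>z. ereal (entropy_density (exp 1) Q P z))
      else \<infinity>)"

text \<open>
  The regularity conditions for log loss: \<open>Q\<close> is the data distribution, \<open>\<nu>\<close> the dominating
  measure and \<open>q\<close> the \<open>\<nu>\<close>-density belonging to the optimal element of the model.  The function
  \<open>- entropy_density (exp 1) \<nu> Q\<close> is \<open>- ln (dQ/d\<nu>)\<close>, whose \<open>Q\<close>-expectation is the differential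
  entropy of \<open>Q\<close>; entropy greater than \<open>- \<infinity>\<close> includes that the entropy is well defined.
\<close>

definition log_loss_regular :: "'z measure \<Rightarrow> 'z measure \<Rightarrow> ('z \<Rightarrow> real) \<Rightarrow> bool" where
  "log_loss_regular Q \<nu> q \<longleftrightarrow>
     absolutely_continuous \<nu> Q \<and>
     ext_KL Q (density \<nu> (\<lambda>z. ennreal (q z))) < \<infinity> \<and>
     has_ext_expectation Q (\<lambda>z. ereal (- entropy_density (exp 1) \<nu> Q z)) \<and>
     ext_expectation Q (\<lambda>z. ereal (- entropy_density (exp 1) \<nu> Q z)) > - \<infinity>"

text \<open>
  The standing assumptions depend on whether the loss is log loss, conditional log loss, or
  neither.  \<open>Log_Loss \<mu> p\<close> is \<open>\<ell>\<^sub>f(z) = - log p\<^sub>f(z)\<close> with densities \<open>p\<^sub>f\<close> relative to \<open>\<mu>\<close>.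
  \<open>Cond_Log_Loss X Y N \<mu> p\<close> is \<open>\<ell>\<^sub>f(x, y) = - log p\<^sub>f(y | x)\<close>, where each \<open>p\<^sub>f(\<cdot> | x)\<close> is a
  density relative to \<open>\<mu>\<close>; here \<open>X\<close> (with values in \<open>N\<close>) and \<open>Y\<close> are the coordinate maps of the
  sample space, for instance \<open>fst\<close> and \<open>snd\<close> on a product.
\<close>

datatype ('f, 'z, 'x, 'y) loss_kind =
    General_Loss
  | Log_Loss "'z measure" "'f \<Rightarrow> 'z \<Rightarrow> real"
  | Cond_Log_Loss "'z \<Rightarrow> 'x" "'z \<Rightarrow> 'y" "'x measure" "'y measure" "'f \<Rightarrow> 'x \<Rightarrow> 'y \<Rightarrow> real"

definition general_loss_assms ::
    "'z measure \<Rightarrow> ('f \<Rightarrow> 'z \<Rightarrow> ereal) \<Rightarrow> 'f set \<Rightarrow> bool" where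
  "general_loss_assms P loss F \<longleftrightarrow> (INF f\<in>F. INF z\<in>space P. loss f z) > - \<infinity>"

definition log_loss_assms ::
    "'z measure \<Rightarrow> ('f \<Rightarrow> 'z \<Rightarrow> ereal) \<Rightarrow> 'f set \<Rightarrow> 'f \<Rightarrow> 'z measure \<Rightarrow> ('f \<Rightarrow> 'z \<Rightarrow> real) \<Rightarrow> bool" where
  "log_loss_assms P loss F fstar \<mu> p \<longleftrightarrow>
     sets \<mu> = sets P \<and> sigma_finite_measure \<mu> \<and>
     (\<forall>f\<in>F. p f \<in> borel_measurable \<mu> \<and> (\<forall>z\<in>space \<mu>. 0 \<le> p f z) \<and>
             (\<integral>\<^sup>+ z. ennreal (p f z) \<partial>\<mu>) = 1) \<and>
     (\<forall>f\<in>F. \<forall>z\<in>space P. loss f z = - ln_ereal (ereal (p f z))) \<and>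
     log_loss_regular P \<mu> (p fstar)"

text \<open>
  In the conditional case the model element \<open>f\<close> stands for the joint distribution with
  \<open>X\<close>-marginal that of \<open>P\<close> and conditional density \<open>p\<^sub>f\<close>, that is, the distribution with density
  \<open>(x, y) \<mapsto> p\<^sub>f(y | x)\<close> relative to the product of the \<open>X\<close>-marginal and \<open>\<mu>\<close>.
\<close>

definition cond_log_loss_assms ::
    "'z measure \<Rightarrow> ('f \<Rightarrow> 'z \<Rightarrow> ereal) \<Rightarrow> 'f set \<Rightarrow> 'f \<Rightarrow> ('z \<Rightarrow> 'x) \<Rightarrow> ('z \<Rightarrow> 'y) \<Rightarrow>
     'x measure \<Rightarrow> 'y measure \<Rightarrow> ('f \<Rightarrow> 'x \<Rightarrow> 'y \<Rightarrow> real) \<Rightarrow> bool" where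
  "cond_log_loss_assms P loss F fstar X Y N \<mu> p \<longleftrightarrow>
     X \<in> measurable P N \<and> Y \<in> measurable P \<mu> \<and> sigma_finite_measure \<mu> \<and>
     (\<forall>f\<in>F. case_prod (p f) \<in> borel_measurable (N \<Otimes>\<^sub>M \<mu>) \<and>
             (\<forall>x\<in>space N. (\<forall>y\<in>space \<mu>. 0 \<le> p f x y) \<and> (\<integral>\<^sup>+ y. ennreal (p f x y) \<partial>\<mu>) = 1)) \<and>
     (\<forall>f\<in>F. \<forall>z\<in>space P. loss f z = - ln_ereal (ereal (p f (X z) (Y z)))) \<and>
     log_loss_regular (distr P (N \<Otimes>\<^sub>M \<mu>) (\<lambda>z. (X z, Y z))) (distr P N X \<Otimes>\<^sub>M \<mu>)
       (case_prod (p fstar))"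

definition excess_loss :: "('f \<Rightarrow> 'z \<Rightarrow> ereal) \<Rightarrow> 'f \<Rightarrow> 'f \<Rightarrow> 'z \<Rightarrow> ereal" where
  "excess_loss loss fstar f z = loss f z - loss fstar z"

text \<open>
  The value \<open>\<infinity> - \<infinity>\<close> can occur in the excess loss only where the loss of \<open>fstar\<close> is infinite,
  which is a \<open>P\<close>-null set under the assumptions of the following locale.
\<close>

locale learning_problem = prob_space P
  for P :: "'z measure" +
  fixes loss :: "'f \<Rightarrow> 'z \<Rightarrow> ereal"
    and F :: "'f set"
    and fstar :: 'f
    and kind :: "('f, 'z, 'x, 'y) loss_kind"
  assumes loss_measurable: "\<And>f. f \<in> F \<Longrightarrow> loss f \<in> borel_measurable P"
    and loss_not_MInfty: "\<And>f z. f \<in> F \<Longrightarrow> z \<in> space P \<Longrightarrow> loss f z \<noteq> - \<infinity>"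
    and loss_kind:
      "case kind of
         General_Loss \<Rightarrow> general_loss_assms P loss F
       | Log_Loss \<mu> p \<Rightarrow> log_loss_assms P loss F fstar \<mu> p
       | Cond_Log_Loss X Y N \<mu> p \<Rightarrow> cond_log_loss_assms P loss F fstar X Y N \<mu> p"
    and finite_risk: "\<exists>f\<in>F. ext_expectation P (loss f) < \<infinity>"
    and fstar_in: "fstar \<in> F"
    and fstar_optimal: "\<And>f. f \<in> F \<Longrightarrow> 0 \<le> ext_expectation P (excess_loss loss fstar f)"

definition strong_central ::
    "'z measure \<Rightarrow> ('f \<Rightarrow> 'z \<Rightarrow> ereal) \<Rightarrow> 'f set \<Rightarrow> 'f \<Rightarrow> real \<Rightarrow> bool" where
  "strong_central P loss F fstar \<eta> \<longleftrightarrow>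
     (\<forall>f\<in>F. ext_expectation P (\<lambda>z. exp_ereal (ereal (- \<eta>) * excess_loss loss fstar f z)) \<le> 1)"

definition witness ::
    "'z measure \<Rightarrow> ('f \<Rightarrow> 'z \<Rightarrow> ereal) \<Rightarrow> 'f set \<Rightarrow> 'f \<Rightarrow> real \<Rightarrow> real \<Rightarrow> bool" where
  "witness P loss F fstar u c \<longleftrightarrow>
     (\<forall>f\<in>F.
        let L = excess_loss loss fstar f
        in ext_expectation P (\<lambda>z. L z * indicator {z. L z \<le> ereal u} z)
             \<ge> ereal c * ext_expectation P L)"

text \<open>
  The function \<open>\<tau>\<close> is only ever used on \<open>{0..}\<close>, because the excess risk is nonnegative.
\<close>

definition tau_witness ::
    "'z measure \<Rightarrow> ('f \<Rightarrow> 'z \<Rightarrow> ereal) \<Rightarrow> 'f set \<Rightarrow> 'f \<Rightarrow> (real \<Rightarrow> real) \<Rightarrow> real \<Rightarrow> bool" where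
  "tau_witness P loss F fstar \<tau> c \<longleftrightarrow>
     (\<forall>f\<in>F.
        let L = excess_loss loss fstar f; r = ext_expectation P L
        in r < \<infinity> \<and>
           ext_expectation P (\<lambda>z. L z * indicator {z. L z \<le> ereal (\<tau> (real_of_ereal r))} z)
             \<ge> ereal c * r)"

definition witness_factor :: "real \<Rightarrow> real \<Rightarrow> real \<Rightarrow> real \<Rightarrow> real" where
  "witness_factor \<eta>bar \<eta> c u = (1 / c) * ((\<eta> * u + 1) / (1 - \<eta> / \<eta>bar))"

end

theory Submission
  imports Defs
begin

text \<open>
  Write \<open>a = \<eta>\<close>, \<open>b = \<eta>bar\<close> and \<open>K = (a u + 1) / (1 - a / b)\<close>.  For every real \<open>x\<close>,
  \<open>x 1{x \<le> u} \<le> K (1 - exp (- a x)) / a + (K - 1) / b (exp (- b x) - 1)\<close>.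
  The strong central condition says that the last term has nonpositive expectation at the excess
  loss, so taking expectations bounds the truncated expectation by \<open>K\<close> times the
  Hellinger-transformed one, and the witness condition turns this into a bound on the full
  expectation.  For \<open>x \<le> u\<close> the pointwise bound reads \<open>B x \<le> K A x\<close> with
  \<open>A x = (1 - exp (- a x)) / a - (1 - exp (- b x)) / b\<close>, which is nonnegative, and
  \<open>B x = x - (1 - exp (- b x)) / b\<close>; by monotonicity in \<open>u\<close> it suffices to take
  \<open>u = max x 0\<close>, where the sign of the derivative of the difference can be read off.
\<close>

section \<open>Pointwise inequalities on the real line\<close>

lemma exp_neg_scaled_antimono:
  fixes a b x :: real
  assumes "0 < a" "a < b"
  shows "(1 - exp (- (b * x))) / b \<le> (1 - exp (- (a * x))) / a"
proof -
  define A where "A x = (1 - exp (- (a * x))) / a - (1 - exp (- (b * x))) / b" for x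
  have d: "(A has_real_derivative exp (- (a * x)) - exp (- (b * x))) (at x)" for x
    unfolding A_def using assms by (auto intro!: derivative_eq_intros)
  \<comment> \<open>The derivative of \<open>A\<close> has the sign of its argument, so
    \<open>A\<close> is minimal at 0, where it vanishes.\<close>
  have "A 0 \<le> A x"
  proof (cases "0 \<le> x")
    case True
    show ?thesis
    proof (rule DERIV_nonneg_imp_nondecreasing[OF True])
      fix y :: real assume "0 \<le> y"
      then have "a * y \<le> b * y" using assms by (intro mult_right_mono) auto
      then show "\<exists>D. (A has_real_derivative D) (at y) \<and> 0 \<le> D"
        using d[of y] by (intro exI conjI) auto
    qed
  next
    case False
    then have le: "x \<le> 0" by simp
    show ?thesis
    proof (rule DERIV_nonpos_imp_nonincreasing[OF le])
      fix y :: real assume "y \<le> 0"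
      then have "b * y \<le> a * y" using assms by (intro mult_right_mono_neg) auto
      then show "\<exists>D. (A has_real_derivative D) (at y) \<and> D \<le> 0"
        using d[of y] by (intro exI conjI) auto
    qed
  qed
  then show ?thesis by (simp add: A_def)
qed

lemma truncation_pointwise_bound:
  fixes a b u x :: real
  assumes ab: "0 < a" "a < b" and u: "0 \<le> u"
  defines "K \<equiv> (a * u + 1) / (1 - a / b)"
  shows "x * indicator {..u} x
      \<le> K * ((1 - exp (- (a * x))) / a) + (K - 1) / b * (exp (- (b * x)) - 1)"
proof -
  define A where "A x = (1 - exp (- (a * x))) / a - (1 - exp (- (b * x))) / b" for x
  define B where "B x = x - (1 - exp (- (b * x))) / b" for x
  have A_nonneg: "0 \<le> A x" for x
    unfolding A_def using exp_neg_scaled_antimono[OF ab] by simp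
  have dA: "(A has_real_derivative exp (- (a * x)) - exp (- (b * x))) (at x)" for x
    unfolding A_def using ab by (auto intro!: derivative_eq_intros)
  have dB: "(B has_real_derivative 1 - exp (- (b * x))) (at x)" for x
    unfolding B_def using ab by (auto intro!: derivative_eq_intros)
  have abA: "a * b * A x = b * (1 - exp (- (a * x))) - a * (1 - exp (- (b * x)))" for x
    unfolding A_def using ab by (simp add: field_simps)
  have K: "K = (a * u + 1) * b / (b - a)"
    unfolding K_def using ab by (simp add: field_simps)
  \<comment> \<open>This is \<open>B x \<le> K * A x\<close> with the positive denominator
    \<open>b - a\<close> cleared.\<close>
  have B_le: "(b - a) * B x \<le> (a * u + 1) * b * A x" if "x \<le> u" for x
  proof (cases "0 \<le> x")
    case True
    \<comment> \<open>The coefficient is the one for \<open>u = x\<close>, the smallest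
      \<open>u\<close> allowed. Larger \<open>u\<close> follow afterwards because \<open>A x\<close>
      is nonnegative.\<close>
    define D where "D x = (a * x + 1) * b * A x - (b - a) * B x" for x
    have "D 0 \<le> D x"
    proof (rule DERIV_nonneg_imp_nondecreasing[OF True])
      fix y :: real assume y: "0 \<le> y"
      then have "a * y \<le> b * y" using ab by (intro mult_right_mono) auto
      then have nn: "0 \<le> a * b * y * (exp (- (a * y)) - exp (- (b * y)))"
        using ab y by simp
      have "(D has_real_derivative
          a * b * A y + (a * y + 1) * b * (exp (- (a * y)) - exp (- (b * y)))
            - (b - a) * (1 - exp (- (b * y)))) (at y)"
        unfolding D_def
        by (rule derivative_eq_intros dA dB refl | simp add: algebra_simps)+
      \<comment> \<open>All terms without a factor \<open>y\<close> cancel.\<close>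
      moreover have "a * b * A y + (a * y + 1) * b * (exp (- (a * y)) - exp (- (b * y)))
            - (b - a) * (1 - exp (- (b * y))) = a * b * y * (exp (- (a * y)) - exp (- (b * y)))"
        unfolding abA by (simp add: algebra_simps)
      ultimately show "\<exists>D'. (D has_real_derivative D') (at y) \<and> 0 \<le> D'"
        using nn by auto
    qed
    then have "(b - a) * B x \<le> (a * x + 1) * b * A x"
      by (simp add: D_def A_def B_def)
    also have "\<dots> \<le> (a * u + 1) * b * A x"
      using that ab A_nonneg by (intro mult_right_mono) auto
    finally show ?thesis .
  next
    case False
    then have le: "x \<le> 0" by simp
    \<comment> \<open>For negative \<open>x\<close> the smallest \<open>u\<close> allowed is 0, so
      the coefficient \<open>a * u + 1\<close> becomes 1. The derivative is then a negative multiple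
      of \<open>A\<close>, so \<open>D\<close> decreases to its value 0 at the origin.\<close>
    define D where "D x = b * A x - (b - a) * B x" for x
    have "D 0 \<le> D x"
    proof (rule DERIV_nonpos_imp_nonincreasing[OF le])
      fix y :: real
      have "(D has_real_derivative
          b * (exp (- (a * y)) - exp (- (b * y))) - (b - a) * (1 - exp (- (b * y)))) (at y)"
        unfolding D_def
        by (rule derivative_eq_intros dA dB refl | simp add: algebra_simps)+
      moreover have "b * (exp (- (a * y)) - exp (- (b * y))) - (b - a) * (1 - exp (- (b * y)))
          = - (a * b * A y)"
        unfolding abA by (simp add: algebra_simps)
      ultimately show "\<exists>D'. (D has_real_derivative D') (at y) \<and> D' \<le> 0"
        using A_nonneg[of y] ab by auto
    qed
    then have "(b - a) * B x \<le> 1 * b * A x"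
      by (simp add: D_def A_def B_def)
    also have "\<dots> \<le> (a * u + 1) * b * A x"
      using ab u A_nonneg by (intro mult_right_mono) auto
    finally show ?thesis .
  qed
  \<comment> \<open>Trading \<open>(1 - exp (- (a * x))) / a\<close> for \<open>A x\<close> leaves,
    beside \<open>K * A x\<close>, exactly the quantity that \<open>B x\<close> subtracts from
    \<open>x\<close>.\<close>
  have rhs: "K * ((1 - exp (- (a * x))) / a) + (K - 1) / b * (exp (- (b * x)) - 1)
      = K * A x + (1 - exp (- (b * x))) / b"
    unfolding A_def using ab by (simp add: field_simps)
  show ?thesis
  proof (cases "x \<le> u")
    case True
    then have "B x \<le> K * A x"
      using B_le[OF True] ab unfolding K by (simp add: field_simps)
    then show ?thesis using True unfolding rhs by (simp add: B_def)
  next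
    \<comment> \<open>Beyond \<open>u\<close> the left side is 0, and both summands on the right are
      nonnegative because \<open>x > u \<ge> 0\<close>.\<close>
    case False
    then have "0 \<le> x" using u by simp
    then have "0 \<le> (1 - exp (- (b * x))) / b" using ab by simp
    moreover have "0 \<le> K * A x" unfolding K using ab u A_nonneg by simp
    ultimately show ?thesis using False unfolding rhs by simp
  qed
qed

section \<open>The bound for integrable real-valued variables\<close>

lemma (in prob_space) truncated_expectation_le:
  fixes g :: "'a \<Rightarrow> real"
  assumes ab: "0 < a" "a < b" and u: "0 \<le> u"
    and g: "integrable M g"
    and eb: "integrable M (\<lambda>z. exp (- (b * g z)))" "expectation (\<lambda>z. exp (- (b * g z))) \<le> 1"
    and ea: "integrable M (\<lambda>z. exp (- (a * g z)))"
  shows "expectation (\<lambda>z. g z * indicator {..u} (g z))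
      \<le> (a * u + 1) / (1 - a / b) * ((1 - expectation (\<lambda>z. exp (- (a * g z)))) / a)"
proof -
  define K where "K = (a * u + 1) / (1 - a / b)"
  \<comment> \<open>This makes \<open>(K - 1) / b\<close> nonnegative, so that an exponential moment
    of at most 1 gives the last term a nonpositive expectation.\<close>
  have "1 \<le> K"
    unfolding K_def using ab u by (simp add: field_simps)
  have [measurable]: "g \<in> borel_measurable M" using g by simp
  have "integrable M (\<lambda>z. g z * indicator {..u} (g z))"
    by (rule Bochner_Integration.integrable_bound[OF g]) (auto split: split_indicator)
  then have "expectation (\<lambda>z. g z * indicator {..u} (g z))
      \<le> expectation (\<lambda>z. K * ((1 - exp (- (a * g z))) / a) + (K - 1) / b * (exp (- (b * g z)) - 1))"
    using truncation_pointwise_bound[OF ab u] ea eb(1)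
    by (intro integral_mono) (auto simp: K_def)
  also have "\<dots> = K * ((1 - expectation (\<lambda>z. exp (- (a * g z)))) / a)
      + (K - 1) / b * (expectation (\<lambda>z. exp (- (b * g z))) - 1)"
    using ea eb(1) by (simp add: prob_space)
  also have "\<dots> \<le> K * ((1 - expectation (\<lambda>z. exp (- (a * g z)))) / a)"
    using \<open>1 \<le> K\<close> ab eb(2) by (simp add: mult_nonneg_nonpos divide_nonpos_pos)
  finally show ?thesis by (simp add: K_def)
qed

section \<open>Extended expectations and the reduction to real-valued variables\<close>

lemma ext_expectation_cong_AE:
  assumes "AE z in M. U z = V z"
  shows "ext_expectation M U = ext_expectation M V"
proof -
  have "(\<integral>\<^sup>+ z. e2ennreal (U z) \<partial>M) = (\<integral>\<^sup>+ z. e2ennreal (V z) \<partial>M)"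
    using assms by (intro nn_integral_cong_AE) auto
  moreover have "(\<integral>\<^sup>+ z. e2ennreal (- U z) \<partial>M) = (\<integral>\<^sup>+ z. e2ennreal (- V z) \<partial>M)"
    using assms by (intro nn_integral_cong_AE) auto
  ultimately show ?thesis by (simp add: ext_expectation_def)
qed

lemma ext_expectation_nonneg_eq:
  assumes "\<And>z. 0 \<le> U z"
  shows "ext_expectation M U = enn2ereal (\<integral>\<^sup>+ z. e2ennreal (U z) \<partial>M)"
proof -
  have "e2ennreal (- U z) = 0" for z
    using assms by (intro e2ennreal_neg) (simp add: ereal_uminus_le_0_iff)
  then show ?thesis by (simp add: ext_expectation_def zero_ennreal.rep_eq)
qed

text \<open>A nonnegative function with finite integral is finite almost everywhere; applied to both
  parts of \<open>U\<close>, this allows the passage from extended expectations to the Bochner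
  integral.\<close>

lemma AE_eq_real_of_ereal:
  fixes U :: "'a \<Rightarrow> ereal"
  assumes [measurable]: "U \<in> borel_measurable M"
    and pos: "(\<integral>\<^sup>+ z. e2ennreal (U z) \<partial>M) < \<infinity>"
    and neg: "(\<integral>\<^sup>+ z. e2ennreal (- U z) \<partial>M) < \<infinity>"
  shows "AE z in M. U z = ereal (real_of_ereal (U z))"
    and "integrable M (\<lambda>z. real_of_ereal (U z))"
proof -
  have "AE z in M. e2ennreal (U z) \<noteq> \<infinity>" "AE z in M. e2ennreal (- U z) \<noteq> \<infinity>"
    using pos neg by (auto intro!: nn_integral_PInf_AE simp del: infinity_ennreal_def)
  then show ae: "AE z in M. U z = ereal (real_of_ereal (U z))"
  proof eventually_elim
    case (elim z)
    then show ?case by (cases "U z") auto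
  qed
  have "(\<integral>\<^sup>+ z. ennreal (real_of_ereal (U z)) \<partial>M) = (\<integral>\<^sup>+ z. e2ennreal (U z) \<partial>M)"
  proof (rule nn_integral_cong_AE)
    show "AE z in M. ennreal (real_of_ereal (U z)) = e2ennreal (U z)"
      using ae by eventually_elim (metis e2ennreal_ereal)
  qed
  moreover have "(\<integral>\<^sup>+ z. ennreal (- real_of_ereal (U z)) \<partial>M) = (\<integral>\<^sup>+ z. e2ennreal (- U z) \<partial>M)"
  proof (rule nn_integral_cong_AE)
    show "AE z in M. ennreal (- real_of_ereal (U z)) = e2ennreal (- U z)"
      using ae by eventually_elim (metis e2ennreal_ereal uminus_ereal.simps(1))
  qed
  ultimately show "integrable M (\<lambda>z. real_of_ereal (U z))"
    using pos neg by (simp add: real_integrable_def less_top)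
qed

lemma exp_ereal_simps [simp]:
  "exp_ereal (ereal r) = ereal (exp r)" "exp_ereal \<infinity> = \<infinity>" "exp_ereal (- \<infinity>) = 0"
  by (simp_all add: exp_ereal_def)

lemma exp_ereal_nonneg: "0 \<le> exp_ereal x"
  by (cases x) auto

text \<open>For a positive real exponential moment \<open>y\<close> this is
  \<open>ln y \<le> y - 1\<close>. The other values follow from the conventions: for
  \<open>y \<le> 0\<close> the annealed side is \<open>\<infinity>\<close>, and for
  \<open>y = \<infinity>\<close> both sides are \<open>- \<infinity>\<close>.\<close>

lemma hellinger_le_annealed:
  assumes "0 < \<eta>"
  shows "hellinger_expectation M \<eta> U \<le> annealed_expectation M \<eta> U"
proof -
  define y where "y = ext_expectation M (\<lambda>z. exp_ereal (ereal (- \<eta>) * U z))"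
  have "ereal (1 / \<eta>) * (1 - y) \<le> ereal (- (1 / \<eta>)) * ln_ereal y"
  proof (cases y)
    case (real r)
    show ?thesis
    proof (cases "0 < r")
      case True
      then have "ln r \<le> r - 1" by (rule ln_le_minus_one)
      then have "(1 / \<eta>) * (1 - r) \<le> (1 / \<eta>) * (- ln r)"
        using assms by (intro mult_left_mono) auto
      then show ?thesis using real True by (simp add: ln_ereal_def one_ereal_def)
    qed (use real assms in \<open>simp add: ln_ereal_def\<close>)
  qed (use assms in \<open>simp_all add: ln_ereal_def one_ereal_def\<close>)
  then show ?thesis
    by (simp add: hellinger_expectation_def annealed_expectation_def y_def)
qed

text \<open>Since \<open>e2ennreal\<close> cuts off at 0, the integrand is the negative part of
  \<open>U\<close>. By \<open>1 + x \<le> exp x\<close>, \<open>b\<close> times it is at most the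
  exponential, whose expectation is at most 1.\<close>

lemma nn_integral_neg_part_finite:
  fixes U :: "'a \<Rightarrow> ereal"
  assumes [measurable]: "U \<in> borel_measurable M" and b: "0 < b"
    and central: "ext_expectation M (\<lambda>z. exp_ereal (ereal (- b) * U z)) \<le> 1"
  shows "(\<integral>\<^sup>+ z. e2ennreal (- U z) \<partial>M) < \<infinity>"
proof -
  let ?W = "\<lambda>z. exp_ereal (ereal (- b) * U z)"
  have "enn2ereal (\<integral>\<^sup>+ z. e2ennreal (?W z) \<partial>M) \<le> enn2ereal 1"
    using central by (simp add: ext_expectation_nonneg_eq exp_ereal_nonneg one_ennreal.rep_eq)
  then have W: "(\<integral>\<^sup>+ z. e2ennreal (?W z) \<partial>M) \<le> 1"
    by (simp add: less_eq_ennreal.rep_eq)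
  have le: "ennreal b * e2ennreal (- U z) \<le> e2ennreal (?W z)" for z
  proof (cases "U z")
    case (real r)
    have "b * (- r) \<le> exp (- (b * r))"
      using exp_ge_add_one_self[of "- (b * r)"] by simp
    then have "ennreal (b * (- r)) \<le> ennreal (exp (- (b * r)))" by (rule ennreal_leI)
    then show ?thesis using real b by (simp add: ennreal_mult' [symmetric] del: ennreal_neg)
  qed (use b in \<open>simp_all add: e2ennreal_neg\<close>)
  have "ennreal b * (\<integral>\<^sup>+ z. e2ennreal (- U z) \<partial>M) = (\<integral>\<^sup>+ z. ennreal b * e2ennreal (- U z) \<partial>M)"
    by (simp add: nn_integral_cmult)
  also have "\<dots> \<le> (\<integral>\<^sup>+ z. e2ennreal (?W z) \<partial>M)"
    using le by (rule nn_integral_mono)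
  also have "\<dots> < \<infinity>" using W by (rule order_le_less_trans) simp
  finally show ?thesis using b by (auto simp: ennreal_mult_less_top)
qed

text \<open>The truncated variable is at most \<open>max u 0\<close> and the measure has mass 1.
  Through the witness inequality this forces the full expectation below
  \<open>\<infinity>\<close>.\<close>

lemma (in prob_space) truncated_ext_expectation_less_PInf:
  fixes U :: "'a \<Rightarrow> ereal"
  shows "ext_expectation M (\<lambda>z. U z * indicator {z. U z \<le> ereal u} z) < \<infinity>"
proof -
  let ?T = "\<lambda>z. U z * indicator {z. U z \<le> ereal u} z"
  have "(\<integral>\<^sup>+ z. e2ennreal (?T z) \<partial>M) \<le> (\<integral>\<^sup>+ z. ennreal u \<partial>M)"
  proof (rule nn_integral_mono)
    fix z
    show "e2ennreal (?T z) \<le> ennreal u"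
      by (cases "U z \<le> ereal u") (auto simp: e2ennreal_mono simp flip: e2ennreal_ereal)
  qed
  also have "\<dots> < \<infinity>" by (simp add: emeasure_space_1)
  finally show ?thesis
    unfolding ext_expectation_def
    by (cases "\<integral>\<^sup>+ z. e2ennreal (?T z) \<partial>M"; cases "\<integral>\<^sup>+ z. e2ennreal (- ?T z) \<partial>M") auto
qed

text \<open>The central condition makes the negative part integrable and the witness inequality the
  positive part. Hence \<open>U\<close> agrees almost everywhere with an integrable real function,
  to which the real-valued bound applies; dividing by \<open>c\<close> completes the
  constant.\<close>

lemma (in prob_space) ext_expectation_le_hellinger:
  fixes U :: "'a \<Rightarrow> ereal"
  assumes U[measurable]: "U \<in> borel_measurable M"
    and ab: "0 < a" "a < b" and u: "0 \<le> u" and c: "0 < c"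
    and central: "ext_expectation M (\<lambda>z. exp_ereal (ereal (- b) * U z)) \<le> 1"
    and wit: "ereal c * ext_expectation M U
        \<le> ext_expectation M (\<lambda>z. U z * indicator {z. U z \<le> ereal u} z)"
  shows "ext_expectation M U \<le> ereal (witness_factor b a c u) * hellinger_expectation M a U"
proof -
  define g where "g z = real_of_ereal (U z)" for z
  have [measurable]: "g \<in> borel_measurable M" unfolding g_def by simp
  have neg: "(\<integral>\<^sup>+ z. e2ennreal (- U z) \<partial>M) < \<infinity>"
    using ab by (intro nn_integral_neg_part_finite[OF U _ central]) simp
  have "ereal c * ext_expectation M U < \<infinity>"
    using wit truncated_ext_expectation_less_PInf by (rule order_le_less_trans)
  then have "ext_expectation M U \<noteq> \<infinity>" using c by auto
  \<comment> \<open>Because \<open>\<infinity> - \<infinity> = \<infinity>\<close>, an infinite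
    positive part would always make the expectation \<open>\<infinity>\<close>.\<close>
  then have pos: "(\<integral>\<^sup>+ z. e2ennreal (U z) \<partial>M) < \<infinity>"
    unfolding ext_expectation_def
    by (cases "\<integral>\<^sup>+ z. e2ennreal (U z) \<partial>M"; cases "\<integral>\<^sup>+ z. e2ennreal (- U z) \<partial>M") auto
  have ae: "AE z in M. U z = ereal (g z)" and g: "integrable M g"
    using AE_eq_real_of_ereal[OF U pos neg] by (simp_all add: g_def[abs_def])
  have E_exp: "ext_expectation M (\<lambda>z. exp_ereal (ereal (- t) * U z))
      = ext_expectation M (\<lambda>z. ereal (exp (- (t * g z))))" for t
    by (intro ext_expectation_cong_AE eventually_mono[OF ae]) simp
  \<comment> \<open>The Bochner integral of a non-integrable function is 0, so integrability is
    first drawn from the nonnegative integral.\<close>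
  have "enn2ereal (\<integral>\<^sup>+ z. ennreal (exp (- (b * g z))) \<partial>M) \<le> enn2ereal 1"
    using central unfolding E_exp by (simp add: ext_expectation_nonneg_eq one_ennreal.rep_eq)
  then have "(\<integral>\<^sup>+ z. ennreal (exp (- (b * g z))) \<partial>M) \<le> 1"
    by (simp add: less_eq_ennreal.rep_eq)
  then have "(\<integral>\<^sup>+ z. ennreal (exp (- (b * g z))) \<partial>M) < \<infinity>"
    by (rule order_le_less_trans) simp
  then have ib: "integrable M (\<lambda>z. exp (- (b * g z)))"
    by (intro integrableI_nonneg) auto
  have eb: "expectation (\<lambda>z. exp (- (b * g z))) \<le> 1"
    using central unfolding E_exp ext_expectation_eq_integral[OF ib] by simp
  \<comment> \<open>As a dominating function, 1 serves where \<open>g\<close> is nonnegative and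
    \<open>exp (- (b * g z))\<close> where it is negative.\<close>
  have "integrable M (\<lambda>z. 1 + exp (- (b * g z)))" using ib by simp
  then have ia: "integrable M (\<lambda>z. exp (- (a * g z)))"
  proof (rule Bochner_Integration.integrable_bound, simp, intro AE_I2)
    fix z
    have "exp (- (a * g z)) \<le> 1 + exp (- (b * g z))"
    proof (cases "0 \<le> g z")
      case True
      then have "exp (- (a * g z)) \<le> 1" using ab by simp
      then show ?thesis by (smt (verit) exp_gt_zero)
    next
      case False
      then have "b * g z \<le> a * g z" using ab by (intro mult_right_mono_neg) auto
      then have "exp (- (a * g z)) \<le> exp (- (b * g z))" by simp
      then show ?thesis by linarith
    qed
    then show "norm (exp (- (a * g z))) \<le> norm (1 + exp (- (b * g z)))" by simp
  qed
  have "integrable M (\<lambda>z. g z * indicator {..u} (g z))"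
    by (rule Bochner_Integration.integrable_bound[OF g]) (auto split: split_indicator)
  then have "ext_expectation M (\<lambda>z. ereal (g z * indicator {..u} (g z)))
      = ereal (expectation (\<lambda>z. g z * indicator {..u} (g z)))"
    by (rule ext_expectation_eq_integral)
  moreover have "ext_expectation M (\<lambda>z. U z * indicator {z. U z \<le> ereal u} z)
      = ext_expectation M (\<lambda>z. ereal (g z * indicator {..u} (g z)))"
    by (intro ext_expectation_cong_AE eventually_mono[OF ae]) (auto split: split_indicator)
  moreover have EU: "ext_expectation M U = ereal (expectation g)"
    using ext_expectation_cong_AE[OF ae] ext_expectation_eq_integral[OF g] by simp
  ultimately have "c * expectation g \<le> expectation (\<lambda>z. g z * indicator {..u} (g z))"
    using wit by simp
  also have "\<dots> \<le> (a * u + 1) / (1 - a / b) * ((1 - expectation (\<lambda>z. exp (- (a * g z)))) / a)"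
    by (rule truncated_expectation_le[OF ab u g ib eb ia])
  finally have "expectation g
      \<le> ((a * u + 1) / (1 - a / b) * ((1 - expectation (\<lambda>z. exp (- (a * g z)))) / a)) / c"
    using c by (simp only: pos_le_divide_eq mult.commute)
  then have "expectation g
      \<le> witness_factor b a c u * ((1 - expectation (\<lambda>z. exp (- (a * g z)))) / a)"
    by (simp add: witness_factor_def mult_ac)
  then show ?thesis
    by (simp add: EU hellinger_expectation_def E_exp ext_expectation_eq_integral[OF ia]
        one_ereal_def)
qed

section \<open>The constant, and both claims of the theorem\<close>

lemma witness_factor_pos:
  assumes "0 < a" "a < b" "0 \<le> u" "0 < c"
  shows "0 < witness_factor b a c u"
  using assms by (simp add: witness_factor_def add_nonneg_pos)

lemma witness_factor_mono:
  assumes "0 < a" "a < b" "0 < c" "u \<le> v"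
  shows "witness_factor b a c u \<le> witness_factor b a c v"
  using assms by (simp add: witness_factor_def divide_right_mono)

theorem lemma13:
  fixes P :: "'z measure"
    and loss :: "'f \<Rightarrow> 'z \<Rightarrow> ereal"
    and F :: "'f set"
    and fstar :: 'f
    and kind :: "('f, 'z, 'x, 'y) loss_kind"
    and \<eta>bar :: real
  assumes "learning_problem P loss F fstar kind"
    and "0 < \<eta>bar"
    and "strong_central P loss F fstar \<eta>bar"
  shows
    "(\<forall>u c. 0 < u \<longrightarrow> 0 < c \<longrightarrow> c \<le> 1 \<longrightarrow> witness P loss F fstar u c \<longrightarrow>
        (\<forall>f\<in>F. \<forall>\<eta>. 0 < \<eta> \<longrightarrow> \<eta> < \<eta>bar \<longrightarrow>
           (let L = excess_loss loss fstar f;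
                C = ereal (witness_factor \<eta>bar \<eta> c u)
            in ext_expectation P L \<le> C * hellinger_expectation P \<eta> L \<and>
               C * hellinger_expectation P \<eta> L \<le> C * annealed_expectation P \<eta> L)))
     \<and>
     (\<forall>\<tau> c. (\<forall>x\<ge>0. 1 \<le> \<tau> x) \<longrightarrow> antimono_on {0..} \<tau> \<longrightarrow> 0 < c \<longrightarrow> c \<le> 1 \<longrightarrow>
        tau_witness P loss F fstar \<tau> c \<longrightarrow>
        (\<forall>lam > 0. \<forall>f\<in>F. \<forall>\<eta>. 0 < \<eta> \<longrightarrow> \<eta> < \<eta>bar \<longrightarrow>
           (let L = excess_loss loss fstar f;
                C = ereal (witness_factor \<eta>bar \<eta> c (\<tau> lam))
            in ext_expectation P L \<le> max (ereal lam) (C * hellinger_expectation P \<eta> L) \<and>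
               max (ereal lam) (C * hellinger_expectation P \<eta> L)
                 \<le> max (ereal lam) (C * annealed_expectation P \<eta> L))))"
proof -
  interpret learning_problem P loss F fstar kind by fact
  have meas: "excess_loss loss fstar f \<in> borel_measurable P" if "f \<in> F" for f
    unfolding excess_loss_def using loss_measurable[OF that] loss_measurable[OF fstar_in]
    by simp
  have central: "ext_expectation P (\<lambda>z. exp_ereal (ereal (- \<eta>bar) * excess_loss loss fstar f z)) \<le> 1"
    if "f \<in> F" for f
    using assms(3) that by (simp add: strong_central_def)
  have HA: "ereal (witness_factor \<eta>bar \<eta> c u) * hellinger_expectation P \<eta> L
      \<le> ereal (witness_factor \<eta>bar \<eta> c u) * annealed_expectation P \<eta> L"
    if "0 < \<eta>" "\<eta> < \<eta>bar" "0 \<le> u" "0 < c" for \<eta> c u and L :: "'z \<Rightarrow> ereal"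
    using witness_factor_pos[OF that] hellinger_le_annealed[OF that(1)]
    by (intro ereal_mult_left_mono) auto
  show ?thesis
  proof (intro conjI allI impI ballI)
    fix u c f \<eta>
    assume "0 < u" "0 < c" "c \<le> 1" and w: "witness P loss F fstar u c"
      and f: "f \<in> F" and \<eta>: "0 < \<eta>" "\<eta> < \<eta>bar"
    moreover have "ext_expectation P (excess_loss loss fstar f)
        \<le> ereal (witness_factor \<eta>bar \<eta> c u) * hellinger_expectation P \<eta> (excess_loss loss fstar f)"
      using w f \<open>0 < u\<close> \<open>0 < c\<close>
      by (intro ext_expectation_le_hellinger[OF meas \<eta> _ _ central])
        (auto simp: witness_def Let_def)
    ultimately show "let L = excess_loss loss fstar f; C = ereal (witness_factor \<eta>bar \<eta> c u)
        in ext_expectation P L \<le> C * hellinger_expectation P \<eta> L \<and>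
           C * hellinger_expectation P \<eta> L \<le> C * annealed_expectation P \<eta> L"
      unfolding Let_def by (intro conjI HA) auto
  next
    fix \<tau> :: "real \<Rightarrow> real" and c lam :: real and f \<eta>
    assume \<tau>1: "\<forall>x\<ge>0. 1 \<le> \<tau> x" and mono: "antimono_on {0..} \<tau>" and c: "0 < c" "c \<le> 1"
      and w: "tau_witness P loss F fstar \<tau> c" and lam: "0 < lam"
      and f: "f \<in> F" and \<eta>: "0 < \<eta>" "\<eta> < \<eta>bar"
    define L where "L = excess_loss loss fstar f"
    let ?H = "hellinger_expectation P \<eta> L"
    let ?C = "\<lambda>u. ereal (witness_factor \<eta>bar \<eta> c u)"
    have "ext_expectation P L < \<infinity>" and "0 \<le> ext_expectation P L"
      using w f fstar_optimal[OF f] by (auto simp: tau_witness_def Let_def L_def)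
    \<comment> \<open>The excess risk is a nonnegative real, so \<open>\<tau>\<close> is evaluated
      inside its domain.\<close>
    then obtain r where r: "ext_expectation P L = ereal r" and r0: "0 \<le> r"
      by (cases "ext_expectation P L") auto
    have \<tau>_nonneg: "0 \<le> \<tau> x" if "0 \<le> x" for x
      using \<tau>1 that by (meson order_trans zero_le_one)
    \<comment> \<open>For this single \<open>f\<close> the condition is an ordinary witness
      inequality with \<open>u = \<tau> r\<close>.\<close>
    have "ereal c * ext_expectation P L
        \<le> ext_expectation P (\<lambda>z. L z * indicator {z. L z \<le> ereal (\<tau> r)} z)"
      using w f r by (auto simp: tau_witness_def Let_def simp flip: L_def)
    then have le: "ext_expectation P L \<le> ?C (\<tau> r) * ?H"
      using f \<tau>_nonneg[OF r0] c meas[OF f] central[OF f] unfolding L_def[symmetric]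
      by (intro ext_expectation_le_hellinger[OF _ \<eta>]) auto
    \<comment> \<open>A risk of at most \<open>lam\<close> is covered by the first argument of the
      maximum; a larger one has \<open>\<tau> r \<le> \<tau> lam\<close>, and the constant grows
      with \<open>u\<close>.\<close>
    have "ext_expectation P L \<le> max (ereal lam) (?C (\<tau> lam) * ?H)"
    proof (cases "r \<le> lam")
      case True
      then show ?thesis by (simp add: r le_max_iff_disj)
    next
      case False
      then have "\<tau> r \<le> \<tau> lam" using mono lam r0 by (auto simp: monotone_on_def)
      then have C_le: "?C (\<tau> r) \<le> ?C (\<tau> lam)" using witness_factor_mono \<eta> c by simp
      \<comment> \<open>Enlarging the constant enlarges the product only if \<open>?H\<close> is
        nonnegative, which the nonnegative risk below the product guarantees.\<close>
      have "0 \<le> ?C (\<tau> r) * ?H" using le r r0 by (simp add: order_trans[rotated])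
      then have "0 \<le> ?H"
        using witness_factor_pos[OF \<eta> \<tau>_nonneg[OF r0] c(1)] by (auto simp: ereal_zero_le_0_iff)
      then have "?C (\<tau> r) * ?H \<le> ?C (\<tau> lam) * ?H"
        using C_le by (rule ereal_mult_right_mono[rotated])
      then show ?thesis using le by (simp add: le_max_iff_disj order_trans)
    qed
    moreover have "max (ereal lam) (?C (\<tau> lam) * ?H)
        \<le> max (ereal lam) (?C (\<tau> lam) * annealed_expectation P \<eta> L)"
      using HA[OF \<eta> \<tau>_nonneg c(1)] lam by (intro max.mono) auto
    ultimately show "let L = excess_loss loss fstar f; C = ereal (witness_factor \<eta>bar \<eta> c (\<tau> lam))
        in ext_expectation P L \<le> max (ereal lam) (C * hellinger_expectation P \<eta> L) \<and>
           max (ereal lam) (C * hellinger_expectation P \<eta> L)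
             \<le> max (ereal lam) (C * annealed_expectation P \<eta> L)"
      unfolding Let_def L_def by simp
  qed
qed

end
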